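(* Let $a\in\mathrm{Lip}(\mathbb{R}^+,\mathbb{R}^+)$ with $\lim_{s\to+\infty}s\,a(s)=0$, and let $M,c>0$. Let $N\in\mathbb{N}$, $N\geq2$, and let $r>0$ be small enough that $N|B(0,r)|\leq c$. Let $R>2r$ be large enough that $s\,a(s)\leq\epsilon<M$ for all $s\geq R-2r$. Let $\{x_1,\dots,x_N\}\in(\mathbb{R}^d)^N$ be such that $\|x_i-x_j\|\geq R$ for all $i\neq j$. If $\mu_0$ satisfies $$\mathrm{supp}(\mu_0)\subset\bigcup_{i=1}^N B(x_i,r),$$ then for $\omega:=\bigcup_{i=1}^N B(x_i,r)\in\Omega_c$ and $u\in\mathcal{U}_M$ defined by $$u(t,x)=\begin{cases}-M\frac{x-x_i}{\|x-x_i\|}&\text{for all }x\in B(x_i,r)\setminus\{x_i\},\ i\in\{1,\dots,N\},\\ 0&\text{otherwise,}\end{cases}$$ the solution of $$\partial_t\mu+\mathrm{div}\big((\xi[\mu]+\chi_\omega u)\mu\big)=0,\qquad\mu(0)=\mu_0,\qquad \xi[\mu](x)=\int_{\mathbb{R}^d}a(\|x-y\|)(y-x)\,d\mu(y),$$ satisfies, for all $t\geq0$, $\mathrm{supp}(\mu(t,\cdot))\subset\bigcup_{i=1}^N B(x_i,r)$.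
   Context: $B(x,r)$ is the ball of center $x$ and radius $r$ in $\mathbb{R}^d$; $|\cdot|$ is Lebesgue measure; $\chi_\omega$ is the indicator function of $\omega$. $\mathcal{U}_M=\{u:\mathbb{R}\times\mathbb{R}^d\to\mathbb{R}^d\text{ measurable}:\|u(t,\cdot)\|_{L^\infty(\mathbb{R}^d)}\leq M\}$, $\Omega_c=\{\omega\subset\mathbb{R}^d:|\omega|\leq c\}$. $\mu(t,\cdot)$ is a compactly supported probability measure on $\mathbb{R}^d$ for every $t$. $\mathrm{Lip}(\mathbb{R}^+,\mathbb{R}^+)$ is the set of Lipschitz functions from $\mathbb{R}^+=[0,\infty)$ to itself. *)

theory Defs
  imports "HOL-Probability.Probability"
begin

definition control_sets :: "real \<Rightarrow> 'a::euclidean_space set set" where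
  "control_sets c = {\<omega>. \<omega> \<in> sets lebesgue \<and> emeasure lebesgue \<omega> \<le> ennreal c}"

definition control_functions :: "real \<Rightarrow> (real \<Rightarrow> 'a::euclidean_space \<Rightarrow> 'a) set" where
  "control_functions M =
    {u. (\<lambda>(t, x). u t x) \<in> borel_measurable borel \<and>
        (\<forall>t. esssup lborel (\<lambda>x. ereal (norm (u t x))) \<le> ereal M)}"

definition msupport :: "'a::topological_space measure \<Rightarrow> 'a set" where
  "msupport \<mu> = {x. \<forall>U. open U \<longrightarrow> x \<in> U \<longrightarrow> emeasure \<mu> U > 0}"

definition compactly_supported_probability :: "'a::euclidean_space measure \<Rightarrow> bool" where
  "compactly_supported_probability \<mu> \<longleftrightarrow>
    sets \<mu> = sets borel \<and> prob_space \<mu> \<and> compact (msupport \<mu>)"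

definition interaction :: "(real \<Rightarrow> real) \<Rightarrow> 'a::euclidean_space measure \<Rightarrow> 'a \<Rightarrow> 'a" where
  "interaction a \<mu> x = (\<integral>y. a (norm (x - y)) *\<^sub>R (y - x) \<partial>\<mu>)"

definition controlled_field ::
  "(real \<Rightarrow> real) \<Rightarrow> 'a::euclidean_space set \<Rightarrow> (real \<Rightarrow> 'a \<Rightarrow> 'a) \<Rightarrow>
    (real \<Rightarrow> 'a measure) \<Rightarrow> real \<Rightarrow> 'a \<Rightarrow> 'a" where
  "controlled_field a \<omega> u \<mu> t x = interaction a (\<mu> t) x + indicator \<omega> x *\<^sub>R u t x"

primrec C_diff :: "nat \<Rightarrow> ('a::euclidean_space \<Rightarrow> real) \<Rightarrow> bool" where
  "C_diff 0 f \<longleftrightarrow> continuous_on UNIV f"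
| "C_diff (Suc k) f \<longleftrightarrow>
    (\<forall>x. f differentiable (at x)) \<and>
    (\<forall>b\<in>Basis. C_diff k (\<lambda>x. frechet_derivative f (at x) b))"

definition test_function :: "('a::euclidean_space \<Rightarrow> real) \<Rightarrow> bool" where
  "test_function \<phi> \<longleftrightarrow> (\<forall>k. C_diff k \<phi>) \<and> compact (closure {x. \<phi> x \<noteq> 0})"

text \<open>
  \<open>continuity_equation w \<mu>\<close>: on \<open>t \<ge> 0\<close>, \<open>\<mu>\<close> is a narrowly continuous curve of compactly supported
  probability measures and a distributional solution of \<open>\<partial>\<^sub>t \<mu> + div (w \<mu>) = 0\<close>, in the usual
  time-integrated weak form. The term \<open>frechet_derivative \<phi> (at x) (w s x)\<close> is the inner product
  of the gradient of \<open>\<phi>\<close> at \<open>x\<close> with \<open>w s x\<close>.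
\<close>

definition continuity_equation ::
  "(real \<Rightarrow> 'a::euclidean_space \<Rightarrow> 'a) \<Rightarrow> (real \<Rightarrow> 'a measure) \<Rightarrow> bool" where
  "continuity_equation w \<mu> \<longleftrightarrow>
    (\<forall>t\<ge>0. compactly_supported_probability (\<mu> t)) \<and>
    (\<forall>f :: 'a \<Rightarrow> real. continuous_on UNIV f \<longrightarrow> bounded (range f) \<longrightarrow>
      continuous_on {0..} (\<lambda>t. \<integral>x. f x \<partial>\<mu> t)) \<and>
    (\<lambda>(t, x). w t x) \<in> borel_measurable borel \<and>
    (\<forall>T\<ge>0. (\<integral>\<^sup>+s\<in>{0..T}. (\<integral>\<^sup>+x. ennreal (norm (w s x)) \<partial>\<mu> s) \<partial>lborel) < \<infinity>) \<and>
    (\<forall>\<phi>. test_function \<phi> \<longrightarrow> (\<forall>t\<ge>0.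
      (\<integral>x. \<phi> x \<partial>\<mu> t) = (\<integral>x. \<phi> x \<partial>\<mu> 0) +
        (LINT s:{0..t}|lborel. (\<integral>x. frechet_derivative \<phi> (at x) (w s x) \<partial>\<mu> s))))"

text \<open>
  The feedbacks of interest are discontinuous: a field \<open>-M (x - z) / |x - z|\<close> drives mass into \<open>z\<close>
  in finite time, after which the pointwise value of the field at \<open>z\<close> (where the control is set to
  \<open>0\<close>) is in general incompatible with the mass staying there. As usual for discontinuous feedback,
  the velocity is therefore allowed to be any selection of the closed convex regularisation of the
  field. Neighbourhoods are not reduced by null sets here, so that this set contains both the value
  of the field itself and Filippov's regularisation.
\<close>

definition convex_regularisation :: "('a::euclidean_space \<Rightarrow> 'a) \<Rightarrow> 'a \<Rightarrow> 'a set" where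
  "convex_regularisation v x = (\<Inter>\<delta>\<in>{0<..}. closure (convex hull (v ` ball x \<delta>)))"

definition kinetic_solution ::
  "(real \<Rightarrow> real) \<Rightarrow> 'a::euclidean_space set \<Rightarrow> (real \<Rightarrow> 'a \<Rightarrow> 'a) \<Rightarrow> 'a measure \<Rightarrow>
    (real \<Rightarrow> 'a measure) \<Rightarrow> bool" where
  "kinetic_solution a \<omega> u \<mu>\<^sub>0 \<mu> \<longleftrightarrow>
    \<mu> 0 = \<mu>\<^sub>0 \<and>
    (\<exists>w. continuity_equation w \<mu> \<and>
      (AE t in lborel. 0 \<le> t \<longrightarrow>
        (AE x in \<mu> t. w t x \<in> convex_regularisation (controlled_field a \<omega> u \<mu> t) x)))"

lemma convex_regularisation_self: "v x \<in> convex_regularisation v x"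
proof -
  have "v x \<in> closure (convex hull (v ` ball x \<delta>))" if "\<delta> > 0" for \<delta>
    using that by (intro closure_subset[THEN subsetD] hull_inc imageI) simp
  then show ?thesis
    by (simp add: convex_regularisation_def)
qed

text \<open>Plain distributional solutions are solutions in the above sense.\<close>

lemma kinetic_solution_of_distributional:
  assumes "continuity_equation (controlled_field a \<omega> u \<mu>) \<mu>" and "\<mu> 0 = \<mu>\<^sub>0"
  shows "kinetic_solution a \<omega> u \<mu>\<^sub>0 \<mu>"
  unfolding kinetic_solution_def
  using assms by (auto intro!: exI[of _ "controlled_field a \<omega> u \<mu>"] simp: convex_regularisation_self)

end

theory Submission
  imports Defs "HOL-Computational_Algebra.Polynomial" "HOL-Real_Asymp.Real_Asymp"
begin

text \<open>
  The initial support lies in the closed balls of some radius \<open>\<rho> < r\<close>. Let \<open>\<psi>\<close> be a smooth radially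
  decreasing cutoff, equal to 1 exactly on these closed balls and 0 outside the balls of a slightly larger
  radius \<open>\<rho>'\<close>. As long as \<open>\<integral> \<psi> d\<mu>(t)\<close> is close to 1, the attraction at a point of an annulus between
  \<open>\<rho>\<close> and \<open>\<rho>'\<close> exceeds \<open>\<epsilon>\<close> in the outward direction only by the small contributions of \<open>\<rho>' - \<rho>\<close> and of
  the mass outside the larger balls. The control \<open>M > \<epsilon>\<close> beats it, so the velocity points inwards
  wherever \<open>\<nabla>\<psi>\<close> is nonzero and \<open>\<integral> \<psi> d\<mu>(t)\<close> cannot decrease: it keeps its initial value 1. The field
  is continuous on the annuli, so the convex regularisation plays no role there.
\<close>

section \<open>Closure properties of \<open>C_diff\<close> functions\<close>

lemma C_diff_continuous: "C_diff k f \<Longrightarrow> continuous_on UNIV f"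
  by (cases k) (auto simp: continuous_on_eq_continuous_within differentiable_imp_continuous_within)

lemma C_diff_Suc_imp: "C_diff (Suc k) f \<Longrightarrow> C_diff k f"
proof (induction k arbitrary: f)
  case 0
  then show ?case using C_diff_continuous by fastforce
next
  case (Suc k)
  then show ?case by (metis C_diff.simps(2))
qed

text \<open>By uniqueness of the derivative, any explicit derivative may replace
  \<open>frechet_derivative\<close> in the recursion. The closure proofs can thus work directly with
  the formulas of the sum, product and chain rules.\<close>

lemma C_diff_SucI:
  assumes "\<And>x. (f has_derivative f' x) (at x)"
    and "\<And>b. b \<in> Basis \<Longrightarrow> C_diff k (\<lambda>x. f' x b)"
  shows "C_diff (Suc k) f"
proof -
  have "frechet_derivative f (at x) = f' x" for x
    using assms(1) by (metis frechet_derivative_at)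
  then show ?thesis
    using assms by (auto simp: differentiable_def)
qed

lemma C_diff_SucE:
  assumes "C_diff (Suc k) f"
  obtains f' where "\<And>x. (f has_derivative f' x) (at x)"
    and "\<And>b. b \<in> Basis \<Longrightarrow> C_diff k (\<lambda>x. f' x b)"
  using assms that[of "\<lambda>x. frechet_derivative f (at x)"]
  by (auto simp: frechet_derivative_works)

lemma C_diff_const: "C_diff k (\<lambda>x. c)"
proof (induction k arbitrary: c)
  case (Suc k)
  show ?case by (rule C_diff_SucI[where f' = "\<lambda>_ _. 0"]) (auto intro: Suc)
qed auto

lemma C_diff_add: "C_diff k f \<Longrightarrow> C_diff k g \<Longrightarrow> C_diff k (\<lambda>x. f x + g x)"
proof (induction k arbitrary: f g)
  case (Suc k)
  obtain f' where f': "\<And>x. (f has_derivative f' x) (at x)"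
    "\<And>b. b \<in> Basis \<Longrightarrow> C_diff k (\<lambda>x. f' x b)"
    using C_diff_SucE[OF Suc.prems(1)] by blast
  obtain g' where g': "\<And>x. (g has_derivative g' x) (at x)"
    "\<And>b. b \<in> Basis \<Longrightarrow> C_diff k (\<lambda>x. g' x b)"
    using C_diff_SucE[OF Suc.prems(2)] by blast
  show ?case
    by (rule C_diff_SucI[where f' = "\<lambda>x h. f' x h + g' x h"])
      (auto intro!: has_derivative_add f' g' Suc.IH)
qed (auto intro: continuous_on_add)

lemma C_diff_sum: "(\<And>i. i \<in> I \<Longrightarrow> C_diff k (f i)) \<Longrightarrow> C_diff k (\<lambda>x. \<Sum>i\<in>I. f i x)"
  by (induction I rule: infinite_finite_induct) (auto intro: C_diff_const C_diff_add)

text \<open>Each summand of the product rule keeps one undifferentiated factor. That factor has one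
  order of smoothness to spare, and \<open>C_diff_Suc_imp\<close> lowers it to the order of the
  induction hypothesis.\<close>

lemma C_diff_mult: "C_diff k f \<Longrightarrow> C_diff k g \<Longrightarrow> C_diff k (\<lambda>x. f x * g x)"
proof (induction k arbitrary: f g)
  case (Suc k)
  obtain f' where f': "\<And>x. (f has_derivative f' x) (at x)"
    "\<And>b. b \<in> Basis \<Longrightarrow> C_diff k (\<lambda>x. f' x b)"
    using C_diff_SucE[OF Suc.prems(1)] by blast
  obtain g' where g': "\<And>x. (g has_derivative g' x) (at x)"
    "\<And>b. b \<in> Basis \<Longrightarrow> C_diff k (\<lambda>x. g' x b)"
    using C_diff_SucE[OF Suc.prems(2)] by blast
  show ?case
    by (rule C_diff_SucI[where f' = "\<lambda>x h. f x * g' x h + f' x h * g x"])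
      (auto intro!: has_derivative_mult f' g' C_diff_add Suc.IH Suc.prems[THEN C_diff_Suc_imp])
qed (auto intro: continuous_on_mult)

lemma C_diff_compose:
  fixes g :: "real \<Rightarrow> real" and f :: "'a::euclidean_space \<Rightarrow> real"
  shows "C_diff k g \<Longrightarrow> C_diff k f \<Longrightarrow> C_diff k (\<lambda>x. g (f x))"
proof (induction k arbitrary: f g)
  case 0
  then show ?case using continuous_on_compose2 by fastforce
next
  case (Suc k)
  obtain f' where f': "\<And>x. (f has_derivative f' x) (at x)"
    "\<And>b. b \<in> Basis \<Longrightarrow> C_diff k (\<lambda>x. f' x b)"
    using C_diff_SucE[OF Suc.prems(2)] by blast
  obtain g' where g': "\<And>x. (g has_derivative g' x) (at x)"
    "\<And>b. b \<in> Basis \<Longrightarrow> C_diff k (\<lambda>x. g' x b)"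
    using C_diff_SucE[OF Suc.prems(1)] by blast
  \<comment> \<open>A linear map on the reals is multiplication by its value at 1. The chain rule
    thus yields a product, to which the induction hypothesis and \<open>C_diff_mult\<close>
    apply.\<close>
  have lin: "g' y h = g' y 1 * h" for y h
    using linear_scale[OF has_derivative_linear[OF g'(1)[of y]], of h 1] by simp
  show ?case
  proof (rule C_diff_SucI)
    show "((\<lambda>x. g (f x)) has_derivative (\<lambda>h. g' (f x) (f' x h))) (at x)" for x
      using has_derivative_compose[OF f'(1) g'(1)] .
    fix b :: 'a assume b: "b \<in> Basis"
    have "C_diff k (\<lambda>x. g' (f x) 1 * f' x b)"
      using Suc.IH[OF g'(2) C_diff_Suc_imp[OF Suc.prems(2)]] by (intro C_diff_mult f'(2) b) simp
    then show "C_diff k (\<lambda>x. g' (f x) (f' x b))"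
      by (subst lin)
  qed
qed

lemma C_diff_inner: "C_diff k (\<lambda>x. x \<bullet> v + c)"
proof (cases k)
  case (Suc n)
  have "((\<lambda>x. x \<bullet> v + c) has_derivative (\<lambda>h. h \<bullet> v)) (at x)" for x
    by (auto intro!: derivative_eq_intros)
  then show ?thesis
    unfolding Suc by (rule C_diff_SucI) (rule C_diff_const)
qed (auto intro!: continuous_intros)

lemma has_derivative_norm_diff_power2:
  fixes z :: "'a::real_inner"
  shows "((\<lambda>x. (norm (x - z))\<^sup>2) has_derivative (\<lambda>h. 2 * ((x - z) \<bullet> h))) (at x within S)"
  unfolding power2_norm_eq_inner
  by (auto intro!: derivative_eq_intros simp: inner_commute)

text \<open>The squared distance is smooth at \<open>z\<close> as well, unlike the distance; the
  cutoffs below are therefore functions of the squared distance. Its partial derivatives are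
  affine.\<close>

lemma C_diff_norm_diff_power2: "C_diff k (\<lambda>x. (norm (x - z))\<^sup>2)"
proof (cases k)
  case (Suc n)
  have "C_diff n (\<lambda>x. 2 * ((x - z) \<bullet> b))" for b :: 'a
    using C_diff_inner[of n "2 *\<^sub>R b" "- (2 * (z \<bullet> b))"]
    by (simp add: inner_diff_left algebra_simps)
  then show ?thesis
    unfolding Suc by (intro C_diff_SucI[OF has_derivative_norm_diff_power2])
qed (auto intro!: continuous_intros)

section \<open>A smooth cutoff on the real line\<close>

text \<open>This family of functions is closed under differentiation, hence consists of smooth functions.\<close>

definition flat_exp :: "real poly \<Rightarrow> real \<Rightarrow> real" where
  "flat_exp p s = (if s > 0 then poly p (1 / s) * exp (- 1 / s) else 0)"

text \<open>With t = 1/s one has d/ds = - t^2 d/dt, so the derivative of p(t) exp(-t) in s is t^2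
  (p(t) - p'(t)) exp(-t). The coefficient list encodes the factor t^2.\<close>

definition flat_exp_deriv :: "real poly \<Rightarrow> real poly" where
  "flat_exp_deriv p = [:0, 0, 1:] * (p - pderiv p)"

lemma tendsto_flat_exp_zero: "(flat_exp p \<longlongrightarrow> 0) (at_right 0)"
proof -
  have 1: "((\<lambda>t. poly p t * exp (- t)) \<longlongrightarrow> 0) at_top"
  proof -
    have "((\<lambda>t. \<Sum>i\<le>degree p. coeff p i * (t ^ i * exp (- t))) \<longlongrightarrow> (\<Sum>i\<le>degree p. coeff p i * 0)) at_top"
      by (intro tendsto_intros) real_asymp
    then show ?thesis
      by (simp add: poly_altdef sum_distrib_right mult.assoc)
  qed
  have "((\<lambda>s. poly p (1 / s) * exp (- (1 / s))) \<longlongrightarrow> 0) (at_right 0)"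
    by (rule filterlim_compose[OF 1]) real_asymp
  then show ?thesis
    by (rule Lim_transform_eventually)
      (auto simp: flat_exp_def eventually_at_filter)
qed

lemma flat_exp_has_derivative:
  "(flat_exp p has_real_derivative flat_exp (flat_exp_deriv p) s) (at s)"
proof -
  consider "s < 0" | "s = 0" | "s > 0" by linarith
  then show ?thesis
  proof cases
    case 1
    have "((\<lambda>_. 0) has_real_derivative 0) (at s)" by simp
    moreover have "eventually (\<lambda>y. flat_exp p y = 0) (nhds s)"
      using eventually_nhds_in_open[of "{..<0}" s] 1
      by (auto simp: flat_exp_def elim!: eventually_mono)
    ultimately show ?thesis
      using 1 DERIV_cong_ev[of s s "flat_exp p" "\<lambda>_. 0" 0 0]
      by (simp add: flat_exp_def)
  next
    case 3
    have "((\<lambda>s. poly p (1 / s) * exp (- 1 / s)) has_real_derivative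
        flat_exp (flat_exp_deriv p) s) (at s)"
      using 3
      by (auto intro!: derivative_eq_intros simp: flat_exp_def flat_exp_deriv_def field_simps power2_eq_square)
    moreover have "eventually (\<lambda>y. flat_exp p y = poly p (1 / y) * exp (- 1 / y)) (nhds s)"
      using eventually_nhds_in_open[of "{0<..}" s] 3
      by (auto simp: flat_exp_def elim!: eventually_mono)
    ultimately show ?thesis
      by (subst DERIV_cong_ev[OF refl _ refl])
  next
    case 2
    \<comment> \<open>For h > 0, dividing by h multiplies the polynomial in 1/h by its variable. The
      right difference quotient at 0 is therefore again a member of the family.\<close>
    have "((\<lambda>h. flat_exp ([:0, 1:] * p) h) \<longlongrightarrow> 0) (at_right 0)"
      by (rule tendsto_flat_exp_zero)
    then have "((\<lambda>h. (flat_exp p (0 + h) - flat_exp p 0) / h) \<longlongrightarrow> 0) (at_right 0)"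
      by (rule Lim_transform_eventually) (auto simp: flat_exp_def eventually_at_filter)
    moreover have "((\<lambda>h. (flat_exp p (0 + h) - flat_exp p 0) / h) \<longlongrightarrow> 0) (at_left 0)"
      by (rule Lim_transform_eventually[OF tendsto_const])
         (auto simp: flat_exp_def eventually_at_filter)
    ultimately show ?thesis
      unfolding 2 DERIV_def by (auto simp: filterlim_split_at flat_exp_def[of _ 0])
  qed
qed

lemma C_diff_flat_exp: "C_diff k (flat_exp p)"
proof (induction k arbitrary: p)
  case 0
  show ?case
    using DERIV_isCont[OF flat_exp_has_derivative] by (simp add: continuous_at_imp_continuous_on)
next
  case (Suc k)
  show ?case
    using flat_exp_has_derivative[of p, unfolded has_field_derivative_def] Suc.IH
    by (intro C_diff_SucI[where f' = "\<lambda>x h. flat_exp (flat_exp_deriv p) x * h"]) auto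
qed

text \<open>Let f(s) = exp(-1/s) for s > 0 and 0 otherwise. The inner f in f(m - f(s - a)) / f(m)
  vanishes up to a, increases strictly afterwards and reaches m = f(b - a) at b, from where on the
  outer f vanishes. The nested form shows the sign of the derivative at once, since f' is
  nonnegative. The strict inequality beyond a makes the level set of 1 exactly a half-line, so that
  a cutoff integral can detect the support.\<close>

lemma smooth_cutoff_exists:
  fixes a b :: real
  assumes "a < b"
  obtains \<eta> \<eta>' where "\<And>s. (\<eta> has_real_derivative \<eta>' s) (at s)" "\<And>k. C_diff k \<eta>"
    "\<And>s. s \<le> a \<Longrightarrow> \<eta> s = 1" "\<And>s. s > a \<Longrightarrow> \<eta> s < 1" "\<And>s. \<eta> s \<ge> 0" "\<And>s. s \<ge> b \<Longrightarrow> \<eta> s = 0"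
    "\<And>s. \<eta>' s \<le> 0" "\<And>s. s \<le> a \<or> s \<ge> b \<Longrightarrow> \<eta>' s = 0"
proof -
  define f f' where "f = flat_exp 1" and "f' = flat_exp (flat_exp_deriv 1)"
  have f: "f s = (if s > 0 then exp (- 1 / s) else 0)" for s
    by (simp add: f_def flat_exp_def)
  have f': "f' s = (if s > 0 then (1 / s\<^sup>2) * exp (- 1 / s) else 0)" for s
    by (simp add: f'_def flat_exp_def flat_exp_deriv_def power2_eq_square)
  have der: "(f has_real_derivative f' s) (at s)" for s
    unfolding f_def f'_def by (rule flat_exp_has_derivative)
  have mono: "f s \<le> f t" if "s \<le> t" for s t
    using that by (auto simp: f field_simps)
  have smono: "f s < f t" if "s < t" "t > 0" for s t
    using that by (auto simp: f field_simps)
  have f'_nonneg: "f' s \<ge> 0" for s by (simp add: f')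
  define m where "m = f (b - a)"
  have m: "m > 0" using assms by (simp add: m_def f)
  have fm: "f m > 0" using m by (simp add: f)
  define \<eta> where "\<eta> s = f (m - f (s - a)) / f m" for s
  define \<eta>' where "\<eta>' s = - (f' (m - f (s - a)) * f' (s - a) / f m)" for s
  show thesis
  proof
    show "(\<eta> has_real_derivative \<eta>' s) (at s)" for s
      unfolding \<eta>_def \<eta>'_def
      by (auto intro!: derivative_eq_intros DERIV_chain2[OF der] simp: less_imp_neq[OF fm, symmetric])
    show "C_diff k \<eta>" for k
    proof -
      have A: "C_diff k (\<lambda>s. s - a)" using C_diff_inner[of k "1::real" "- a"] by (simp only: inner_real_def mult_1_right diff_conv_add_uminus)
      have B: "C_diff k f" unfolding f_def by (rule C_diff_flat_exp)
      have "C_diff k (\<lambda>s. (1 / f m) * f (m + (-1) * f (s - a)))"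
        by (intro C_diff_mult C_diff_add C_diff_const C_diff_compose[OF B] A)
      then show ?thesis by (simp add: \<eta>_def[abs_def])
    qed
    show "\<eta> s = 1" if "s \<le> a" for s using that fm by (simp add: \<eta>_def f[of "s - a"])
    show "\<eta> s < 1" if "s > a" for s
      using that fm m smono[of "m - f (s - a)" m] by (simp add: \<eta>_def f[of "s - a"])
    show "\<eta> s \<ge> 0" for s by (simp add: \<eta>_def f)
    show "\<eta> s = 0" if "s \<ge> b" for s
      using mono[of "b - a" "s - a"] that by (simp add: \<eta>_def m_def f[of "_ - f _"])
    show "\<eta>' s \<le> 0" for s
      using fm f'_nonneg by (simp add: \<eta>'_def)
    show "\<eta>' s = 0" if "s \<le> a \<or> s \<ge> b" for s
      using mono[of "b - a" "s - a"] that by (auto simp: \<eta>'_def m_def f'[of "_ - f _"] f'[of "s - a"])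
  qed
qed

section \<open>Supports and convex regularisation\<close>

text \<open>The complement of the support is a union of open null sets; by the Lindelof property
  countably many of them suffice, so the union is null.\<close>

lemma AE_msupport:
  fixes \<mu> :: "'a::second_countable_topology measure"
  assumes sets: "sets \<mu> = sets borel"
  shows "AE x in \<mu>. x \<in> msupport \<mu>"
proof -
  define F where "F = {U. open U \<and> emeasure \<mu> U = 0}"
  obtain F' where F': "F' \<subseteq> F" "countable F'" "\<Union>F' = \<Union>F"
    using Lindelof[of F] by (auto simp: F_def)
  have "F' \<subseteq> null_sets \<mu>"
    using F' sets by (auto simp: F_def intro!: null_setsI)
  then have "\<Union>F' \<in> null_sets \<mu>"
    using null_sets_UN'[OF F'(2), of "\<lambda>U. U" \<mu>] by auto
  then have "\<Union>F \<in> null_sets \<mu>" using F' by simp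
  moreover have "{x \<in> space \<mu>. x \<notin> msupport \<mu>} \<subseteq> \<Union>F"
    by (auto simp: msupport_def F_def)
  ultimately show ?thesis by (rule AE_I')
qed

text \<open>Near \<open>x\<close> the values of \<open>v\<close> stay in a small closed ball around
  \<open>v x\<close>. This ball is closed and convex, so it also contains the closed convex hull of
  the values.\<close>

lemma convex_regularisation_continuous:
  assumes "isCont v x"
  shows "convex_regularisation v x = {v x}"
proof -
  have "y = v x" if y: "y \<in> convex_regularisation v x" for y
  proof -
    have "dist (v x) y \<le> e" if "e > 0" for e
    proof -
      obtain d where d: "d > 0" "\<And>z. dist z x < d \<Longrightarrow> dist (v z) (v x) < e"
        using assms \<open>e > 0\<close> unfolding continuous_at_eps_delta by blast
      have "v ` ball x d \<subseteq> cball (v x) e"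
        using d(2) by (force simp: dist_commute less_imp_le)
      then have "closure (convex hull (v ` ball x d)) \<subseteq> cball (v x) e"
        by (intro closure_minimal hull_minimal) auto
      then show ?thesis
        using y d(1) by (force simp: convex_regularisation_def)
    qed
    then show ?thesis
      by (metis dist_eq_0_iff dense_ge zero_le_dist order_antisym)
  qed
  then show ?thesis using convex_regularisation_self by blast
qed

section \<open>Continuity and bounds of the interaction field\<close>

lemma continuous_on_interaction_kernel:
  fixes f g :: "'b::topological_space \<Rightarrow> 'a::euclidean_space"
  assumes "continuous_on {0..} a" "continuous_on S f" "continuous_on S g"
  shows "continuous_on S (\<lambda>y. a (norm (f y - g y)) *\<^sub>R (g y - f y))"
  by (intro continuous_intros continuous_on_compose2[OF assms(1)] assms(2,3)) auto

context
  fixes a :: "real \<Rightarrow> real" and \<mu> :: "'a::euclidean_space measure" and B :: real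
  assumes prob: "prob_space \<mu>" and sets_mu: "sets \<mu> = sets borel"
    and a_cont: "continuous_on {0..} a"
    and a_nonneg: "\<And>s. s \<ge> 0 \<Longrightarrow> a s \<ge> 0"
    and a_bound: "\<And>s. s \<ge> 0 \<Longrightarrow> s * a s \<le> B"
begin

interpretation prob_space \<mu> by (rule prob)

lemma interaction_kernel_measurable: "(\<lambda>y. a (norm (x - y)) *\<^sub>R (y - x)) \<in> borel_measurable \<mu>"
proof -
  have "(\<lambda>y. a (norm (x - y)) *\<^sub>R (y - x)) \<in> borel_measurable borel"
    by (intro borel_measurable_continuous_onI continuous_on_interaction_kernel[OF a_cont] continuous_intros)
  then show ?thesis
    using measurable_cong_sets[OF sets_mu refl] by blast
qed

lemma norm_interaction_kernel_le: "norm (a (norm (x - y)) *\<^sub>R (y - x)) \<le> B"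
  using a_bound[of "norm (x - y)"] a_nonneg[of "norm (x - y)"]
  by (simp add: norm_minus_commute mult.commute)

text \<open>The kernel has norm s a(s) with s = |x - y|, hence is bounded by \<open>B\<close>. This
  constant is integrable for a probability measure and serves for dominated convergence.\<close>

lemma interaction_isCont: "isCont (interaction a \<mu>) x"
  unfolding continuous_at_sequentially o_def
proof (intro allI impI)
  fix X assume X: "X \<longlonglongrightarrow> x"
  show "(\<lambda>n. interaction a \<mu> (X n)) \<longlonglongrightarrow> interaction a \<mu> x"
    unfolding interaction_def
  proof (rule integral_dominated_convergence[where w = "\<lambda>_. B"])
    have "continuous_on UNIV (\<lambda>z. a (norm (z - y)) *\<^sub>R (y - z))" for y :: 'a
      by (intro continuous_on_interaction_kernel[OF a_cont] continuous_intros)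
    then have "(\<lambda>n. a (norm (X n - y)) *\<^sub>R (y - X n)) \<longlonglongrightarrow> a (norm (x - y)) *\<^sub>R (y - x)" for y
      using X by (rule continuous_on_tendsto_compose) auto
    then show "AE y in \<mu>. (\<lambda>n. a (norm (X n - y)) *\<^sub>R (y - X n)) \<longlonglongrightarrow> a (norm (x - y)) *\<^sub>R (y - x)"
      by simp
  qed (auto intro!: interaction_kernel_measurable norm_interaction_kernel_le simp del: norm_scaleR)
qed

text \<open>The mass is split into the part in \<open>G\<close>, which pulls in direction
  \<open>e\<close> with at most \<open>\<kappa>\<close>, and the rest, where only the global bound
  \<open>B\<close> is available. As \<open>\<kappa>\<close> is nonnegative, \<open>\<kappa>\<close>
  plus \<open>B\<close> times the indicator of the complement dominates the integrand
  everywhere.\<close>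

lemma interaction_inner_le:
  assumes G: "G \<in> sets borel" and e: "norm e \<le> 1" and \<kappa>: "\<kappa> \<ge> 0"
    and le: "\<And>y. y \<in> G \<Longrightarrow> a (norm (x - y)) * ((y - x) \<bullet> e) \<le> \<kappa>"
  shows "interaction a \<mu> x \<bullet> e \<le> \<kappa> + B * (1 - prob G)"
proof -
  have B: "B \<ge> 0" using a_bound[of 0] by simp
  have G': "G \<in> events" "UNIV - G \<in> events" and sp: "space \<mu> = UNIV"
    using G sets_mu sets_eq_imp_space_eq[OF sets_mu] by auto
  have int: "integrable \<mu> (\<lambda>y. a (norm (x - y)) *\<^sub>R (y - x))"
    by (rule integrable_const_bound[where B = B])
      (auto intro!: norm_interaction_kernel_le interaction_kernel_measurable simp del: norm_scaleR)
  have "interaction a \<mu> x \<bullet> e = (\<integral>y. (a (norm (x - y)) *\<^sub>R (y - x)) \<bullet> e \<partial>\<mu>)"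
    unfolding interaction_def using int by (rule integral_inner_left[symmetric])
  also have "\<dots> \<le> (\<integral>y. \<kappa> + B * indicator (UNIV - G) y \<partial>\<mu>)"
  proof (rule integral_mono)
    show "integrable \<mu> (\<lambda>y. (a (norm (x - y)) *\<^sub>R (y - x)) \<bullet> e)"
      using int by (rule integrable_inner_left)
    show "integrable \<mu> (\<lambda>y. \<kappa> + B * indicator (UNIV - G) y)"
      using G'(2) by (intro Bochner_Integration.integrable_add integrable_const integrable_mult_right)
        (auto simp: emeasure_eq_measure)
    fix y
    show "(a (norm (x - y)) *\<^sub>R (y - x)) \<bullet> e \<le> \<kappa> + B * indicator (UNIV - G) y"
    proof (cases "y \<in> G")
      case True
      then show ?thesis using le[of y] by simp
    next
      case False
      have "(a (norm (x - y)) *\<^sub>R (y - x)) \<bullet> e \<le> norm (a (norm (x - y)) *\<^sub>R (y - x)) * norm e"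
        by (rule norm_cauchy_schwarz)
      also have "\<dots> \<le> B * 1"
        using e B norm_interaction_kernel_le by (intro mult_mono) auto
      finally show ?thesis using False \<kappa> by simp
    qed
  qed
  also have "\<dots> = \<kappa> + B * prob (UNIV - G)"
    using G'(2) by (subst Bochner_Integration.integral_add)
      (use prob_space sp in \<open>auto simp: emeasure_eq_measure\<close>)
  also have "prob (UNIV - G) = 1 - prob G"
    using prob_compl[OF G'(1)] sp by simp
  finally show ?thesis .
qed

end

text \<open>Beyond some \<open>S0 >= 1\<close> the limit gives s a(s) < 1, and a(s) <= s a(s) there.
  On the compact interval up to \<open>S0\<close>, continuity bounds a by some \<open>A\<close> and
  s a(s) by \<open>S0 * A\<close>.\<close>

lemma bounded_interaction_potential:
  fixes a :: "real \<Rightarrow> real"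
  assumes cont: "continuous_on {0..} a" and nonneg: "\<And>s. s \<ge> 0 \<Longrightarrow> a s \<ge> 0"
    and lim: "((\<lambda>s. s * a s) \<longlongrightarrow> 0) at_top"
  obtains B where "B > 0" "\<And>s. s \<ge> 0 \<Longrightarrow> a s \<le> B" "\<And>s. s \<ge> 0 \<Longrightarrow> s * a s \<le> B"
proof -
  have "eventually (\<lambda>s. s * a s < 1 \<and> s \<ge> 1) at_top"
    using order_tendstoD(2)[OF lim, of 1] eventually_ge_at_top[of 1] by (auto intro: eventually_conj)
  then obtain S0 where S0: "\<And>s. s \<ge> S0 \<Longrightarrow> s * a s < 1 \<and> s \<ge> 1"
    unfolding eventually_at_top_linorder by blast
  then have S1: "S0 \<ge> 1" by blast
  have "compact (a ` {0..S0})"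
    by (intro compact_continuous_image continuous_on_subset[OF cont]) auto
  then obtain A where "\<And>v. v \<in> a ` {0..S0} \<Longrightarrow> \<bar>v\<bar> \<le> A"
    using compact_imp_bounded bounded_real by metis
  then have A: "a s \<le> A" if "s \<in> {0..S0}" for s
    using that abs_le_D1 by blast
  have A0: "A \<ge> 0" using A[of 0] nonneg[of 0] S1 by simp
  define B where "B = max 1 (S0 * A)"
  have AB: "A \<le> B" using A0 S1 mult_right_mono[of 1 S0 A] by (simp add: B_def)
  have small: "a s \<le> B \<and> s * a s \<le> B" if "s \<ge> 0" "s \<le> S0" for s
    using that A[of s] AB mult_mono[of s S0 "a s" A] nonneg[of s] S1 by (auto simp: B_def)
  have large: "a s \<le> B \<and> s * a s \<le> B" if "s \<ge> S0" for s
    using S0[OF that] mult_right_mono[of 1 s "a s"] nonneg[of s] by (auto simp: B_def)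
  show thesis
  proof
    show "B > 0" by (simp add: B_def)
    show "a s \<le> B" "s * a s \<le> B" if "s \<ge> 0" for s
      using that small[of s] large[of s] by linarith+
  qed
qed

section \<open>A barrier argument in time and a compactness argument in space\<close>

text \<open>If \<open>g\<close> dropped below 1, the first time it reaches a level in \<open>{1 - \<delta>..<1}\<close> would
  contradict the hypothesis.\<close>

lemma continuous_barrier:
  fixes g :: "real \<Rightarrow> real"
  assumes cont: "continuous_on {0..} g" and \<delta>: "\<delta> > 0"
    and step: "\<And>t. t \<ge> 0 \<Longrightarrow> (\<And>s. 0 \<le> s \<Longrightarrow> s < t \<Longrightarrow> g s \<ge> 1 - \<delta>) \<Longrightarrow> g t \<ge> 1"
    and t: "t \<ge> 0"
  shows "g t \<ge> 1"
proof (rule ccontr)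
  assume neg: "\<not> g t \<ge> 1"
  define m where "m = max (1 - \<delta>) (g t)"
  have m: "m < 1" "m \<ge> 1 - \<delta>" "m \<ge> g t" using neg \<delta> by (auto simp: m_def)
  define S where "S = {s \<in> {0..t}. g s \<le> m}"
  have "closed S"
    unfolding S_def
    by (intro continuous_on_closed_Collect_le continuous_on_subset[OF cont] continuous_intros) auto
  moreover have "S \<subseteq> {0..t}" by (auto simp: S_def)
  ultimately have "compact S"
    by (meson bounded_closed_interval bounded_subset compact_eq_bounded_closed)
  moreover have "t \<in> S" using t m by (simp add: S_def)
  ultimately obtain s where s: "s \<in> S" "\<And>q. q \<in> S \<Longrightarrow> s \<le> q"
    using compact_attains_inf[of S] by blast
  have "g q \<ge> 1 - \<delta>" if "0 \<le> q" "q < s" for q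
    using s(2)[of q] s(1) that m by (force simp: S_def)
  then have "g s \<ge> 1" using s(1) by (intro step) (auto simp: S_def)
  then show False using s(1) m by (simp add: S_def)
qed

text \<open>The distance to the finite set of centres attains its maximum on \<open>S\<close>, and
  this maximum is below \<open>r\<close>. Applied to the initial support, this leaves room for an
  annulus inside the control region.\<close>

lemma compact_subset_UN_ball_shrink:
  fixes S X :: "'a::heine_borel set"
  assumes S: "compact S" "S \<subseteq> (\<Union>z\<in>X. ball z r)" and X: "finite X" and r: "r > 0"
  obtains \<rho> where "0 \<le> \<rho>" "\<rho> < r" "S \<subseteq> (\<Union>z\<in>X. cball z \<rho>)"
proof (cases "S = {}")
  case True
  then show thesis using that[of 0] r by simp
next
  case False
  obtain q where q: "q \<in> S" "\<And>y. y \<in> S \<Longrightarrow> infdist y X \<le> infdist q X"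
    using continuous_attains_sup[OF S(1) False continuous_on_infdist[OF continuous_on_id]] by blast
  have X0: "X \<noteq> {}" using S False by auto
  show thesis
  proof (rule that[of "infdist q X"])
    show "infdist q X \<ge> 0" by (rule infdist_nonneg)
    obtain z where "z \<in> X" "dist z q < r" using q(1) S by auto
    then show "infdist q X < r" using infdist_le[of z X q] by (simp add: dist_commute)
    show "S \<subseteq> (\<Union>z\<in>X. cball z (infdist q X))"
    proof
      fix y assume "y \<in> S"
      moreover obtain z where "z \<in> X" "infdist y X = dist y z"
        using infdist_attains_inf[OF finite_imp_closed[OF X] X0] .
      ultimately show "y \<in> (\<Union>z\<in>X. cball z (infdist q X))"
        using q(2)[of y] by (auto simp: dist_commute)
    qed
  qed
qed

section \<open>A smooth cutoff around the clusters\<close>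

text \<open>The cutoff is a sum of radial cutoffs. The balls of radius \<open>\<rho>'\<close> are
  disjoint by \<open>sep\<close>, so at most one summand is nonzero at each point, which gives the
  bound 1 and the level set of 1. The gradient is a sum of terms 2 (y - x_i)
  \<open>\<eta>'\<close>(|y - x_i|^2) with \<open>\<eta>'\<close> nonpositive and zero off the
  annuli; an inward velocity therefore does not decrease the cutoff.\<close>

lemma cluster_cutoff_exists:
  fixes x :: "'i \<Rightarrow> 'a::euclidean_space"
  assumes I: "finite I" and \<rho>: "0 \<le> \<rho>" "\<rho> < \<rho>'"
    and sep: "\<And>i j. i \<in> I \<Longrightarrow> j \<in> I \<Longrightarrow> i \<noteq> j \<Longrightarrow> norm (x i - x j) \<ge> 2 * \<rho>'"
  obtains \<psi> D where "test_function \<psi>" "\<And>y. (\<psi> has_derivative D y) (at y)"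
    "\<And>y. 0 \<le> \<psi> y" "\<And>y. \<psi> y \<le> 1" "\<And>y. \<psi> y = 1 \<longleftrightarrow> y \<in> (\<Union>i\<in>I. cball (x i) \<rho>)"
    "\<And>y. y \<notin> (\<Union>i\<in>I. ball (x i) \<rho>') \<Longrightarrow> \<psi> y = 0"
    "\<And>y h. (\<And>i. i \<in> I \<Longrightarrow> \<rho> < norm (y - x i) \<Longrightarrow> norm (y - x i) < \<rho>' \<Longrightarrow> (y - x i) \<bullet> h \<le> 0)
      \<Longrightarrow> 0 \<le> D y h"
proof -
  have sq: "\<rho>\<^sup>2 < \<rho>'\<^sup>2" using \<rho> by (simp add: power_strict_mono)
  obtain \<eta> \<eta>' where \<eta>: "\<And>s. (\<eta> has_real_derivative \<eta>' s) (at s)" "\<And>k. C_diff k \<eta>"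
    "\<And>s. s \<le> \<rho>\<^sup>2 \<Longrightarrow> \<eta> s = 1" "\<And>s. s > \<rho>\<^sup>2 \<Longrightarrow> \<eta> s < 1" "\<And>s. \<eta> s \<ge> 0" "\<And>s. s \<ge> \<rho>'\<^sup>2 \<Longrightarrow> \<eta> s = 0"
    "\<And>s. \<eta>' s \<le> 0" "\<And>s. s \<le> \<rho>\<^sup>2 \<or> s \<ge> \<rho>'\<^sup>2 \<Longrightarrow> \<eta>' s = 0"
  proof (rule smooth_cutoff_exists[OF sq], goal_cases)
    case (1 \<eta> \<eta>')
    show ?case by (rule 1(1); fact 1)
  qed
  define \<psi> where "\<psi> y = (\<Sum>i\<in>I. \<eta> ((norm (y - x i))\<^sup>2))" for y
  define D where "D y h = (\<Sum>i\<in>I. 2 * ((y - x i) \<bullet> h) * \<eta>' ((norm (y - x i))\<^sup>2))" for y h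
  have far: "\<eta> ((norm (y - x i))\<^sup>2) = 0" if "y \<notin> ball (x i) \<rho>'" for y i
    using that \<rho> by (intro \<eta>(6) power_mono) (auto simp: dist_norm norm_minus_commute)
  have out: "\<psi> y = 0" if "y \<notin> (\<Union>i\<in>I. ball (x i) \<rho>')" for y
    unfolding \<psi>_def using that by (intro sum.neutral ballI far) auto
  have near: "\<psi> y = \<eta> ((norm (y - x i))\<^sup>2)" if i: "i \<in> I" "y \<in> ball (x i) \<rho>'" for y i
  proof -
    have "y \<notin> ball (x j) \<rho>'" if "j \<in> I - {i}" for j
    proof
      assume "y \<in> ball (x j) \<rho>'"
      then have "dist (x i) (x j) < 2 * \<rho>'"
        using i(2) dist_triangle_less_add[of "x i" y \<rho>' "x j" \<rho>'] by (simp add: dist_commute)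
      then show False using sep[of i j] i that by (auto simp: dist_norm)
    qed
    then have "(\<Sum>j\<in>I - {i}. \<eta> ((norm (y - x j))\<^sup>2)) = 0"
      by (intro sum.neutral ballI far)
    then show ?thesis
      unfolding \<psi>_def using sum.remove[OF I i(1), of "\<lambda>j. \<eta> ((norm (y - x j))\<^sup>2)"] by simp
  qed
  have \<eta>_less: "\<eta> ((norm (y - x i))\<^sup>2) < 1" if "y \<notin> cball (x i) \<rho>" for y i
    using that \<rho> by (intro \<eta>(4) power_strict_mono) (auto simp: dist_norm norm_minus_commute)
  have \<eta>_one: "\<eta> ((norm (y - x i))\<^sup>2) = 1" if "y \<in> cball (x i) \<rho>" for y i
    using that by (intro \<eta>(3) power_mono) (auto simp: dist_norm norm_minus_commute)
  have iff: "\<psi> y = 1 \<longleftrightarrow> y \<in> (\<Union>i\<in>I. cball (x i) \<rho>)" for y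
  proof
    assume "\<psi> y = 1"
    then obtain i where i: "i \<in> I" "y \<in> ball (x i) \<rho>'" using out[of y] by fastforce
    then have "y \<in> cball (x i) \<rho>" using near[OF i] \<eta>_less[of y i] \<open>\<psi> y = 1\<close> by fastforce
    then show "y \<in> (\<Union>i\<in>I. cball (x i) \<rho>)" using i by blast
  next
    assume "y \<in> (\<Union>i\<in>I. cball (x i) \<rho>)"
    then obtain i where i: "i \<in> I" "y \<in> cball (x i) \<rho>" by blast
    moreover have "y \<in> ball (x i) \<rho>'" using i(2) \<rho> by auto
    ultimately show "\<psi> y = 1" using near[of i y] \<eta>_one[of y i] by simp
  qed
  show thesis
  proof
    have "C_diff k \<psi>" for k
      unfolding \<psi>_def by (intro C_diff_sum C_diff_compose[OF \<eta>(2) C_diff_norm_diff_power2])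
    moreover have "{y. \<psi> y \<noteq> 0} \<subseteq> (\<Union>i\<in>I. ball (x i) \<rho>')" using out by blast
    then have "bounded {y. \<psi> y \<noteq> 0}"
      by (rule bounded_subset[rotated]) (auto intro: bounded_UN[OF I])
    ultimately show "test_function \<psi>" by (simp add: test_function_def)
    show "(\<psi> has_derivative D y) (at y)" for y
      unfolding \<psi>_def D_def
      by (intro has_derivative_sum DERIV_compose_FDERIV[OF \<eta>(1) has_derivative_norm_diff_power2])
    show "0 \<le> \<psi> y" for y unfolding \<psi>_def by (intro sum_nonneg \<eta>(5))
    show "\<psi> y \<le> 1" for y
    proof (cases "y \<in> (\<Union>i\<in>I. ball (x i) \<rho>')")
      case True
      then obtain i where i: "i \<in> I" "y \<in> ball (x i) \<rho>'" by blast
      then show ?thesis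
        using near[OF i] \<eta>_less[of y i] \<eta>_one[of y i] by (cases "y \<in> cball (x i) \<rho>") auto
    qed (simp add: out)
    show "\<psi> y = 1 \<longleftrightarrow> y \<in> (\<Union>i\<in>I. cball (x i) \<rho>)" for y by (rule iff)
    show "\<psi> y = 0" if "y \<notin> (\<Union>i\<in>I. ball (x i) \<rho>')" for y using that by (rule out)
    show "0 \<le> D y h" if in_le: "\<And>i. i \<in> I \<Longrightarrow> \<rho> < norm (y - x i) \<Longrightarrow> norm (y - x i) < \<rho>' \<Longrightarrow> (y - x i) \<bullet> h \<le> 0"
      for y h
      unfolding D_def
    proof (rule sum_nonneg)
      fix i assume i: "i \<in> I"
      show "0 \<le> 2 * ((y - x i) \<bullet> h) * \<eta>' ((norm (y - x i))\<^sup>2)"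
      proof (cases "\<rho> < norm (y - x i) \<and> norm (y - x i) < \<rho>'")
        case True
        then show ?thesis using in_le[OF i] \<eta>(7) by (intro mult_nonpos_nonpos) auto
      next
        case False
        then have "(norm (y - x i))\<^sup>2 \<le> \<rho>\<^sup>2 \<or> \<rho>'\<^sup>2 \<le> (norm (y - x i))\<^sup>2"
          using \<rho> by (auto simp: not_less intro: power_mono)
        then show ?thesis using \<eta>(8) by simp
      qed
    qed
  qed
qed

section \<open>The attraction felt in an annulus\<close>

text \<open>The slack \<open>A * (\<rho>' - \<rho>)\<close> accounts for the particles \<open>z\<close> of cluster \<open>i\<close> lying farther
  from its centre than \<open>y\<close>, the only ones in this cluster that pull \<open>y\<close> outwards.\<close>

lemma cluster_attraction_le:
  fixes x :: "'i \<Rightarrow> 'a::euclidean_space"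
  assumes a_nonneg: "\<And>s. s \<ge> 0 \<Longrightarrow> a s \<ge> 0" and a_le: "\<And>s. s \<ge> 0 \<Longrightarrow> a s \<le> A"
    and far: "\<And>s. s \<ge> R - 2 * r \<Longrightarrow> s * a s \<le> \<epsilon>" and \<epsilon>: "\<epsilon> \<ge> 0"
    and sep: "\<And>j. j \<in> I \<Longrightarrow> j \<noteq> i \<Longrightarrow> norm (x i - x j) \<ge> R"
    and \<rho>: "0 \<le> \<rho>" "\<rho> < \<rho>'" "\<rho>' \<le> r"
    and y: "\<rho> < norm (y - x i)" "norm (y - x i) < \<rho>'"
    and z: "z \<in> (\<Union>j\<in>I. ball (x j) \<rho>')"
  shows "a (norm (y - z)) * ((z - y) \<bullet> sgn (y - x i)) \<le> \<epsilon> + A * (\<rho>' - \<rho>)"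
proof -
  let ?e = "sgn (y - x i)"
  have A: "A \<ge> 0" using a_nonneg[of 0] a_le[of 0] by simp
  have y_ne: "y \<noteq> x i" using y(1) \<rho>(1) by auto
  then have e: "norm ?e = 1" by (simp add: norm_sgn)
  obtain j where j: "j \<in> I" "dist (x j) z < \<rho>'" using z by auto
  show ?thesis
  proof (cases "j = i")
    case True
    have "(z - y) \<bullet> ?e = (z - x i) \<bullet> ?e - (y - x i) \<bullet> ?e" by (simp add: inner_diff_left)
    also have "(y - x i) \<bullet> ?e = norm (y - x i)"
      using y_ne by (simp add: sgn_div_norm power2_norm_eq_inner[symmetric] power2_eq_square)
    also have "(z - x i) \<bullet> ?e \<le> norm (z - x i) * norm ?e" by (rule norm_cauchy_schwarz)
    also have "\<dots> \<le> \<rho>'" using e j True by (simp add: dist_norm norm_minus_commute)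
    finally have "(z - y) \<bullet> ?e \<le> \<rho>' - \<rho>" using y(1) by simp
    then have "a (norm (y - z)) * ((z - y) \<bullet> ?e) \<le> a (norm (y - z)) * (\<rho>' - \<rho>)"
      by (intro mult_left_mono a_nonneg) auto
    also have "\<dots> \<le> A * (\<rho>' - \<rho>)"
      using \<rho> by (intro mult_right_mono a_le) auto
    finally show ?thesis using \<epsilon> by simp
  next
    case False
    \<comment> \<open>Both points lie within \<open>\<rho>' <= r\<close> of their respective
      centres, which are at least \<open>R\<close> apart; this leaves the distance R - 2r at which
      \<open>far\<close> applies.\<close>
    have "norm (x i - x j) \<le> norm (y - x i) + norm (y - z) + dist (x j) z"
      by (simp add: dist_norm) norm
    then have "norm (y - z) \<ge> R - 2 * r"
      using sep[OF j(1) False] y(2) j(2) \<rho>(3) by linarith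
    then have "norm (y - z) * a (norm (y - z)) \<le> \<epsilon>" by (rule far)
    moreover have "(z - y) \<bullet> ?e \<le> norm (y - z)"
      using norm_cauchy_schwarz[of "z - y" ?e] e by (simp add: norm_minus_commute)
    then have "a (norm (y - z)) * ((z - y) \<bullet> ?e) \<le> a (norm (y - z)) * norm (y - z)"
      by (intro mult_left_mono a_nonneg) auto
    moreover have "0 \<le> A * (\<rho>' - \<rho>)" using A \<rho> by simp
    ultimately show ?thesis by (simp add: mult.commute)
  qed
qed

section \<open>Admissibility of the control region and of the feedback\<close>

lemma UN_ball_in_control_sets:
  fixes x :: "'i \<Rightarrow> 'a::euclidean_space"
  assumes I: "finite I" and c: "real (card I) * measure lebesgue (ball (0::'a) r) \<le> c"
  shows "(\<Union>i\<in>I. ball (x i) r) \<in> control_sets c"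
proof -
  have ball: "emeasure lebesgue (ball (x i) r) = ennreal (measure lebesgue (ball (0::'a) r))" for i
  proof (cases "r \<ge> 0")
    case True
    have "emeasure lebesgue (ball (x i) r) = ennreal (measure lebesgue (ball (x i) r))"
      using emeasure_lborel_ball_finite[of "x i" r] by (intro emeasure_eq_ennreal_measure) auto
    also have "measure lebesgue (ball (x i) r) = measure lebesgue (ball (0::'a) r)"
      using content_ball_conv_unit_ball[OF True, of "x i"] content_ball_conv_unit_ball[OF True, of "0::'a"]
      by simp
    finally show ?thesis .
  qed (simp add: ball_empty)
  have "emeasure lebesgue (\<Union>i\<in>I. ball (x i) r) \<le> (\<Sum>i\<in>I. emeasure lebesgue (ball (x i) r))"
    by (rule emeasure_subadditive_finite[OF I]) auto
  also have "\<dots> = ennreal (real (card I) * measure lebesgue (ball (0::'a) r))"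
    by (simp add: ball ennreal_mult' ennreal_of_nat_eq_real_of_nat)
  also have "\<dots> \<le> ennreal c" using c by (rule ennreal_leI)
  finally have "emeasure lebesgue (\<Union>i\<in>I. ball (x i) r) \<le> ennreal c" .
  moreover have "(\<Union>i\<in>I. ball (x i) r) \<in> sets lebesgue"
    by (rule sets.finite_UN[OF I]) auto
  ultimately show ?thesis by (simp add: control_sets_def)
qed

text \<open>A finite sum makes measurability immediate. The balls are disjoint, so at most one term
  is nonzero, and \<open>sgn 0 = 0\<close> reproduces the value 0 of the feedback at the
  centres.\<close>

lemma cluster_feedback_eq:
  fixes x :: "'i \<Rightarrow> 'a::euclidean_space"
  assumes I: "finite I"
    and sep: "\<And>i j. i \<in> I \<Longrightarrow> j \<in> I \<Longrightarrow> i \<noteq> j \<Longrightarrow> norm (x i - x j) \<ge> 2 * r"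
    and inside: "\<And>t i y. i \<in> I \<Longrightarrow> y \<in> ball (x i) r - {x i} \<Longrightarrow> u t y = - (M *\<^sub>R ((y - x i) /\<^sub>R norm (y - x i)))"
    and outside: "\<And>t y. y \<notin> (\<Union>i\<in>I. ball (x i) r - {x i}) \<Longrightarrow> u t y = 0"
  shows "u t y = (\<Sum>i\<in>I. indicator (ball (x i) r) y *\<^sub>R - (M *\<^sub>R sgn (y - x i)))"
proof (cases "y \<in> (\<Union>i\<in>I. ball (x i) r - {x i})")
  case False
  then show ?thesis
    using outside[OF False, of t] by (auto intro!: sum.neutral simp: indicator_def)
next
  case True
  then obtain i where i: "i \<in> I" "y \<in> ball (x i) r - {x i}" by blast
  have "y \<notin> ball (x j) r" if "j \<in> I - {i}" for j
  proof
    assume "y \<in> ball (x j) r"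
    then have "dist (x i) (x j) < 2 * r"
      using i(2) dist_triangle_less_add[of "x i" y r "x j" r] by (simp add: dist_commute)
    then show False using sep[of i j] i that by (auto simp: dist_norm)
  qed
  then have "(\<Sum>j\<in>I - {i}. indicator (ball (x j) r) y *\<^sub>R - (M *\<^sub>R sgn (y - x j))) = 0"
    by (intro sum.neutral ballI) (simp add: indicator_def)
  then show ?thesis
    using sum.remove[OF I i(1), of "\<lambda>j. indicator (ball (x j) r) y *\<^sub>R - (M *\<^sub>R sgn (y - x j))"]
      inside[OF i, of t] i(2) by (simp add: sgn_div_norm)
qed

lemma cluster_feedback_in_control_functions:
  fixes x :: "'i \<Rightarrow> 'a::euclidean_space"
  assumes I: "finite I" and M: "M \<ge> 0"
    and sep: "\<And>i j. i \<in> I \<Longrightarrow> j \<in> I \<Longrightarrow> i \<noteq> j \<Longrightarrow> norm (x i - x j) \<ge> 2 * r"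
    and inside: "\<And>t i y. i \<in> I \<Longrightarrow> y \<in> ball (x i) r - {x i} \<Longrightarrow> u t y = - (M *\<^sub>R ((y - x i) /\<^sub>R norm (y - x i)))"
    and outside: "\<And>t y. y \<notin> (\<Union>i\<in>I. ball (x i) r - {x i}) \<Longrightarrow> u t y = 0"
  shows "u \<in> control_functions M"
proof -
  define U where "U y = (\<Sum>i\<in>I. indicator (ball (x i) r) y *\<^sub>R - (M *\<^sub>R sgn (y - x i)))" for y
  have u: "u = (\<lambda>t. U)"
    unfolding U_def by (intro ext cluster_feedback_eq[OF I sep inside outside])
  have U: "U \<in> borel_measurable borel"
    unfolding U_def sgn_div_norm
    by (intro borel_measurable_sum borel_measurable_scaleR borel_measurable_indicator borel_open
        borel_measurable_uminus borel_measurable_inverse borel_measurable_norm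
        borel_measurable_diff borel_measurable_const measurable_ident) auto
  have "(\<lambda>(t::real, y). U y) = U \<circ> snd" by auto
  also have "\<dots> \<in> borel_measurable borel"
    by (intro measurable_comp[OF _ U] borel_measurable_continuous_onI continuous_intros)
  finally have meas: "(\<lambda>(t::real, y). U y) \<in> borel_measurable borel" .
  have "norm (u t y) \<le> M" for t y
  proof (cases "y \<in> (\<Union>i\<in>I. ball (x i) r - {x i})")
    case True
    then obtain i where "i \<in> I" "y \<in> ball (x i) r - {x i}" by blast
    with inside[of i y t] M show ?thesis by (auto simp: mult.assoc)
  qed (use outside[of y t] M in auto)
  then have "esssup lborel (\<lambda>y. ereal (norm (u t y))) \<le> ereal M" for t
    using U by (intro esssup_I) (auto simp: u)
  with meas show ?thesis by (simp add: control_functions_def u)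
qed

section \<open>Integrals of the cutoff\<close>

lemma integrable_cutoff:
  fixes \<psi> :: "'a::topological_space \<Rightarrow> real"
  assumes "prob_space \<mu>" "sets \<mu> = sets borel" "continuous_on UNIV \<psi>"
    and "\<And>y. 0 \<le> \<psi> y" "\<And>y. \<psi> y \<le> 1"
  shows "integrable \<mu> \<psi>"
proof -
  interpret prob_space \<mu> by fact
  have "\<psi> \<in> borel_measurable \<mu>"
    using borel_measurable_continuous_onI[OF assms(3)] measurable_cong_sets[OF assms(2) refl] by blast
  then show ?thesis
    by (intro integrable_const_bound[where B = 1]) (auto simp: assms)
qed

lemma integral_cutoff_le:
  fixes \<psi> :: "'a::topological_space \<Rightarrow> real"
  assumes prob: "prob_space \<mu>" and sets: "sets \<mu> = sets borel" and cont: "continuous_on UNIV \<psi>"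
    and range: "\<And>y. 0 \<le> \<psi> y" "\<And>y. \<psi> y \<le> 1"
    and G: "G \<in> sets borel" and zero: "\<And>y. y \<notin> G \<Longrightarrow> \<psi> y = 0"
  shows "(\<integral>y. \<psi> y \<partial>\<mu>) \<le> measure \<mu> G"
proof -
  interpret prob_space \<mu> by fact
  have G: "G \<in> events" using G sets by simp
  have "(\<integral>y. \<psi> y \<partial>\<mu>) \<le> (\<integral>y. indicator G y \<partial>\<mu>)"
  proof (rule integral_mono)
    show "integrable \<mu> \<psi>" by (rule integrable_cutoff[OF prob sets cont range])
    show "integrable \<mu> (indicator G :: _ \<Rightarrow> real)" using G by (simp add: emeasure_eq_measure)
    show "\<psi> y \<le> indicator G y" for y using range[of y] zero[of y] by (cases "y \<in> G") auto
  qed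
  then show ?thesis using G by simp
qed

text \<open>This turns the claim on supports into one on a scalar function of time. The integral is
  1 exactly if \<open>\<psi> = 1\<close> almost everywhere. The set where \<open>\<psi>\<close>
  differs from 1 is open, so if it is null it misses the support; the converse is
  \<open>AE_msupport\<close>.\<close>

lemma msupport_subset_iff_cutoff:
  fixes \<psi> :: "'a::second_countable_topology \<Rightarrow> real"
  assumes prob: "prob_space \<mu>" and sets: "sets \<mu> = sets borel" and cont: "continuous_on UNIV \<psi>"
    and range: "\<And>y. 0 \<le> \<psi> y" "\<And>y. \<psi> y \<le> 1"
  shows "msupport \<mu> \<subseteq> {y. \<psi> y = 1} \<longleftrightarrow> (\<integral>y. \<psi> y \<partial>\<mu>) = 1"
proof -
  interpret prob_space \<mu> by fact
  have int: "integrable \<mu> \<psi>" by (rule integrable_cutoff[OF assms])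
  have int': "integrable \<mu> (\<lambda>y. 1 - \<psi> y)"
    by (intro Bochner_Integration.integrable_diff int) auto
  have "(\<integral>y. 1 - \<psi> y \<partial>\<mu>) = 1 - (\<integral>y. \<psi> y \<partial>\<mu>)"
    using int by (simp add: prob_space)
  moreover have "(\<integral>y. 1 - \<psi> y \<partial>\<mu>) = 0 \<longleftrightarrow> (AE y in \<mu>. 1 - \<psi> y = 0)"
    by (intro integral_nonneg_eq_0_iff_AE[OF int']) (auto simp: range)
  ultimately have *: "(\<integral>y. \<psi> y \<partial>\<mu>) = 1 \<longleftrightarrow> (AE y in \<mu>. \<psi> y = 1)"
    by auto
  have "msupport \<mu> \<subseteq> {y. \<psi> y = 1}" if AE1: "AE y in \<mu>. \<psi> y = 1"
  proof
    fix y assume y: "y \<in> msupport \<mu>"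
    have op: "open {y. \<psi> y \<noteq> 1}"
      by (intro open_Collect_neq cont continuous_intros)
    have "emeasure \<mu> {y. \<psi> y \<noteq> 1} = 0"
      using AE1 op sets sets_eq_imp_space_eq[OF sets] by (subst (asm) AE_iff_measurable[OF _ refl]) auto
    then show "y \<in> {y. \<psi> y = 1}"
      using y op unfolding msupport_def by force
  qed
  moreover have "AE y in \<mu>. \<psi> y = 1" if "msupport \<mu> \<subseteq> {y. \<psi> y = 1}"
    using AE_msupport[OF sets] by eventually_elim (use that in auto)
  ultimately show ?thesis using * by blast
qed

section \<open>Invariance of the clusters\<close>

text \<open>Near a point of \<open>\<omega>\<close> other than the centre \<open>z\<close>, the
  indicator is 1 and the feedback is given by the radial formula, which is singular only at
  \<open>z\<close>.\<close>

lemma isCont_controlled_field: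
  assumes "isCont (interaction a (\<mu> t)) y" and \<omega>: "open \<omega>" "y \<in> \<omega>" and z: "y \<noteq> z"
    and U: "open U" "y \<in> U" and u: "\<And>y. y \<in> U - {z} \<Longrightarrow> u t y = - (M *\<^sub>R sgn (y - z))"
  shows "isCont (controlled_field a \<omega> u \<mu> t) y"
proof -
  have "isCont (\<lambda>y. interaction a (\<mu> t) y - M *\<^sub>R sgn (y - z)) y"
    unfolding sgn_div_norm using assms(1) z by (intro continuous_intros) auto
  moreover have "eventually (\<lambda>y. y \<in> \<omega> \<inter> (U - {z})) (nhds y)"
    using \<omega> U z by (intro eventually_nhds_in_open) (auto intro: open_Diff)
  then have "eventually (\<lambda>y. controlled_field a \<omega> u \<mu> t y = interaction a (\<mu> t) y - M *\<^sub>R sgn (y - z)) (nhds y)"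
    by eventually_elim (auto simp: controlled_field_def u)
  ultimately show ?thesis by (subst isCont_cong)
qed

lemma kinetic_solution_clusters_invariant:
  fixes x :: "'i \<Rightarrow> 'a::euclidean_space" and a :: "real \<Rightarrow> real"
  defines "\<omega> \<equiv> \<lambda>I r. \<Union>i\<in>I. ball (x i) r"
  assumes I: "finite I" and r: "r > 0" and R: "R > 2 * r" and M: "\<epsilon> < M"
    and a_cont: "continuous_on {0..} a" and a_nonneg: "\<And>s. s \<ge> 0 \<Longrightarrow> a s \<ge> 0"
    and a_lim: "((\<lambda>s. s * a s) \<longlongrightarrow> 0) at_top"
    and far: "\<And>s. s \<ge> R - 2 * r \<Longrightarrow> s * a s \<le> \<epsilon>"
    and sep: "\<And>i j. i \<in> I \<Longrightarrow> j \<in> I \<Longrightarrow> i \<noteq> j \<Longrightarrow> norm (x i - x j) \<ge> R"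
    and u: "\<And>t i y. i \<in> I \<Longrightarrow> y \<in> ball (x i) r - {x i} \<Longrightarrow> u t y = - (M *\<^sub>R sgn (y - x i))"
    and supp0: "msupport \<mu>\<^sub>0 \<subseteq> \<omega> I r"
    and sol: "kinetic_solution a (\<omega> I r) u \<mu>\<^sub>0 \<mu>" and t: "t \<ge> 0"
  shows "msupport (\<mu> t) \<subseteq> \<omega> I r"
proof -
  obtain w where cty: "continuity_equation w \<mu>"
    and w: "AE t in lborel. 0 \<le> t \<longrightarrow>
      (AE y in \<mu> t. w t y \<in> convex_regularisation (controlled_field a (\<omega> I r) u \<mu> t) y)"
    and mu0: "\<mu> 0 = \<mu>\<^sub>0"
    using sol unfolding kinetic_solution_def by blast
  have csp: "sets (\<mu> t) = sets borel" "prob_space (\<mu> t)" "compact (msupport (\<mu> t))" if "t \<ge> 0" for t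
    using cty that unfolding continuity_equation_def compactly_supported_probability_def by auto
  have narrow: "continuous_on {0..} (\<lambda>t. \<integral>x. f x \<partial>\<mu> t)"
    if "continuous_on UNIV f" "bounded (range f)" for f :: "'a \<Rightarrow> real"
    using cty that unfolding continuity_equation_def by blast
  have weak: "(\<integral>x. \<phi> x \<partial>\<mu> t) = (\<integral>x. \<phi> x \<partial>\<mu> 0) +
        (LINT s:{0..t}|lborel. (\<integral>x. frechet_derivative \<phi> (at x) (w s x) \<partial>\<mu> s))"
    if "test_function \<phi>" "t \<ge> 0" for \<phi> t
    using cty that unfolding continuity_equation_def by blast
  obtain B where B: "B > 0" "\<And>s. s \<ge> 0 \<Longrightarrow> a s \<le> B" "\<And>s. s \<ge> 0 \<Longrightarrow> s * a s \<le> B"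
    using bounded_interaction_potential[OF a_cont a_nonneg a_lim] by blast
  \<comment> \<open>The sign of \<open>\<epsilon>\<close> follows from \<open>far\<close> at the
    positive endpoint R - 2r.\<close>
  have "0 \<le> (R - 2 * r) * a (R - 2 * r)" using R a_nonneg by simp
  also have "\<dots> \<le> \<epsilon>" by (rule far) simp
  finally have \<epsilon>: "\<epsilon> \<ge> 0" .
  have "msupport (\<mu> 0) \<subseteq> (\<Union>z\<in>x ` I. ball z r)" using supp0 mu0 by (simp add: \<omega>_def)
  then obtain \<rho> where \<rho>: "0 \<le> \<rho>" "\<rho> < r" and "msupport (\<mu> 0) \<subseteq> (\<Union>z\<in>x ` I. cball z \<rho>)"
    by (rule compact_subset_UN_ball_shrink[OF csp(3)[OF order_refl] _ finite_imageI[OF I] r])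
  then have supp_\<rho>: "msupport (\<mu> 0) \<subseteq> (\<Union>i\<in>I. cball (x i) \<rho>)" by simp
  \<comment> \<open>The gap M - \<open>\<epsilon>\<close> is shared in halves: one bounds the
    outward pull B (\<open>\<rho>'\<close> - \<open>\<rho>\<close>) of the own cluster, the other
    the pull B \<open>\<delta>\<close> of the mass outside \<open>G\<close>. The minimum with
    \<open>r\<close> keeps the annuli in the region where the control acts.\<close>
  define \<rho>' where "\<rho>' = min r (\<rho> + (M - \<epsilon>) / (2 * B))"
  define \<delta> where "\<delta> = (M - \<epsilon>) / (2 * B)"
  have \<delta>: "\<delta> > 0" using M B(1) by (simp add: \<delta>_def)
  have \<rho>': "\<rho> < \<rho>'" "\<rho>' \<le> r" using \<rho> \<delta> by (auto simp: \<rho>'_def \<delta>_def)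
  have "\<rho>' - \<rho> \<le> \<delta>" by (simp add: \<rho>'_def \<delta>_def)
  then have "B * (\<rho>' - \<rho>) \<le> B * \<delta>" using B(1) by simp
  moreover have "B * \<delta> = (M - \<epsilon>) / 2" using B(1) by (simp add: \<delta>_def)
  ultimately have balance: "\<epsilon> + B * (\<rho>' - \<rho>) + B * \<delta> \<le> M" by simp
  have sep': "norm (x i - x j) \<ge> 2 * \<rho>'" if "i \<in> I" "j \<in> I" "i \<noteq> j" for i j
    using sep[OF that] \<rho>' R by simp
  define G where "G = (\<Union>i\<in>I. ball (x i) \<rho>')"
  have G: "G \<in> sets borel" unfolding G_def by (intro borel_open open_UN ballI open_ball)
  obtain \<psi> D where \<psi>: "test_function \<psi>" "\<And>y. (\<psi> has_derivative D y) (at y)"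
    "\<And>y. 0 \<le> \<psi> y" "\<And>y. \<psi> y \<le> 1" "\<And>y. \<psi> y = 1 \<longleftrightarrow> y \<in> (\<Union>i\<in>I. cball (x i) \<rho>)"
    "\<And>y. y \<notin> G \<Longrightarrow> \<psi> y = 0"
    and D: "\<And>y h. (\<And>i. i \<in> I \<Longrightarrow> \<rho> < norm (y - x i) \<Longrightarrow> norm (y - x i) < \<rho>' \<Longrightarrow> (y - x i) \<bullet> h \<le> 0)
      \<Longrightarrow> 0 \<le> D y h"
  proof (rule cluster_cutoff_exists[of I \<rho> \<rho>' x], goal_cases)
    case (5 \<psi> D)
    show ?case by (rule 5(1)) (fact 5[folded G_def])+
  qed (use I \<rho> \<rho>' sep' in auto)
  have cont: "continuous_on UNIV \<psi>"
    using has_derivative_continuous[OF \<psi>(2)] by (simp add: continuous_on_eq_continuous_within)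
  have K: "{y. \<psi> y = 1} = (\<Union>i\<in>I. cball (x i) \<rho>)" using \<psi>(5) by blast
  define g where "g t = (\<integral>y. \<psi> y \<partial>\<mu> t)" for t
  have g1_iff: "msupport (\<mu> t) \<subseteq> (\<Union>i\<in>I. cball (x i) \<rho>) \<longleftrightarrow> g t = 1" if "t \<ge> 0" for t
    unfolding g_def K[symmetric]
    by (rule msupport_subset_iff_cutoff[OF csp(2,1)[OF that] cont \<psi>(3,4)])
  have g_le: "g t \<le> measure (\<mu> t) G" if "t \<ge> 0" for t
    unfolding g_def
    by (rule integral_cutoff_le[OF csp(2,1)[OF that] cont \<psi>(3,4) G \<psi>(6)])
  \<comment> \<open>At such times at most \<open>\<delta>\<close> of the mass lies outside
    \<open>G\<close>, since \<open>g\<close> is bounded by the mass of \<open>G\<close>. The outward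
    pull in an annulus is then at most \<open>M\<close>, which the control cancels.\<close>
  have inward: "(y - x i) \<bullet> controlled_field a (\<omega> I r) u \<mu> s y \<le> 0"
    "isCont (controlled_field a (\<omega> I r) u \<mu> s) y"
    if s: "s \<ge> 0" "g s \<ge> 1 - \<delta>" and i: "i \<in> I" "\<rho> < norm (y - x i)" "norm (y - x i) < \<rho>'" for s y i
  proof -
    have y: "y \<noteq> x i" "y \<in> ball (x i) r"
      using i \<rho> \<rho>' by (auto simp: dist_norm norm_minus_commute)
    have y\<omega>: "y \<in> \<omega> I r" using y i by (auto simp: \<omega>_def)
    note inter = csp(2,1)[OF s(1)] a_cont a_nonneg B(3)
    show "isCont (controlled_field a (\<omega> I r) u \<mu> s) y"
      using y y\<omega> u[OF i(1)]
      by (intro isCont_controlled_field[where U = "ball (x i) r" and z = "x i"] interaction_isCont[OF inter])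
        (auto simp: \<omega>_def)
    have "interaction a (\<mu> s) y \<bullet> sgn (y - x i) \<le> (\<epsilon> + B * (\<rho>' - \<rho>)) + B * (1 - measure (\<mu> s) G)"
    proof (rule interaction_inner_le[OF inter])
      show "0 \<le> \<epsilon> + B * (\<rho>' - \<rho>)" using \<epsilon> B(1) \<rho>' by simp
      show "a (norm (y - z)) * ((z - y) \<bullet> sgn (y - x i)) \<le> \<epsilon> + B * (\<rho>' - \<rho>)" if "z \<in> G" for z
        by (rule cluster_attraction_le[where R = R and r = r and I = I])
          (use that a_nonneg B(2) far \<epsilon> sep[OF i(1)] \<rho>(1) \<rho>' i in \<open>auto simp: G_def\<close>)
    qed (auto simp: G norm_sgn)
    also have "\<dots> \<le> (\<epsilon> + B * (\<rho>' - \<rho>)) + B * \<delta>"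
      using g_le[OF s(1)] s(2) B(1) by simp
    also have "\<dots> \<le> M" by (rule balance)
    finally have "controlled_field a (\<omega> I r) u \<mu> s y \<bullet> sgn (y - x i) \<le> M * (1 - sgn (y - x i) \<bullet> sgn (y - x i))"
      using y y\<omega> u[OF i(1), of y s] by (simp add: controlled_field_def inner_diff_left inner_add_left right_diff_distrib)
    also have "sgn (y - x i) \<bullet> sgn (y - x i) = 1"
      using y by (simp add: norm_sgn flip: power2_norm_eq_inner)
    finally have "norm (y - x i) * (controlled_field a (\<omega> I r) u \<mu> s y \<bullet> sgn (y - x i)) \<le> 0"
      by (simp add: mult_nonneg_nonpos)
    then show "(y - x i) \<bullet> controlled_field a (\<omega> I r) u \<mu> s y \<le> 0"
      using y by (simp add: sgn_div_norm inner_commute flip: mult.assoc)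
  qed
  have "g t \<ge> 1" if "t \<ge> 0" for t
  proof (rule continuous_barrier[OF _ \<delta> _ that])
    have "bounded (range \<psi>)"
      by (rule boundedI[where B = 1]) (use \<psi>(3,4) in auto)
    then show "continuous_on {0..} g" unfolding g_def by (rule narrow[OF cont])
    fix t :: real assume t: "t \<ge> 0" and above: "\<And>s. 0 \<le> s \<Longrightarrow> s < t \<Longrightarrow> g s \<ge> 1 - \<delta>"
    \<comment> \<open>The hypothesis \<open>above\<close> covers \<open>s < t\<close> only; the
      endpoint is discarded as a null set.\<close>
    have "AE s in lborel. 0 \<le> indicator {0..t} s *\<^sub>R (\<integral>y. frechet_derivative \<psi> (at y) (w s y) \<partial>\<mu> s)"
      using w AE_lborel_singleton[of t]
    proof eventually_elim
      case (elim s)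
      show ?case
      proof (cases "s \<in> {0..t}")
        case True
        then have s: "s \<ge> 0" "g s \<ge> 1 - \<delta>" using above[of s] elim(2) by auto
        have "AE y in \<mu> s. 0 \<le> frechet_derivative \<psi> (at y) (w s y)"
          using elim(1)[rule_format, OF s(1)]
        proof eventually_elim
          case (elim y)
          have "0 \<le> D y (w s y)"
          proof (rule D)
            \<comment> \<open>Only annuli need to be inspected. The field is continuous there, so
              its regularisation is a singleton and forces \<open>w\<close> to equal the
              field.\<close>
            fix i assume i: "i \<in> I" "\<rho> < norm (y - x i)" "norm (y - x i) < \<rho>'"
            have "w s y = controlled_field a (\<omega> I r) u \<mu> s y"
              using elim convex_regularisation_continuous[OF inward(2)[OF s i]] by simp
            then show "(y - x i) \<bullet> w s y \<le> 0" using inward(1)[OF s i] by simp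
          qed
          then show ?case using frechet_derivative_at[OF \<psi>(2), of y] by simp
        qed
        \<comment> \<open>The Bochner integral of a nonintegrable function is 0 by convention, so
          nonnegativity almost everywhere suffices, here and for the integral in time.\<close>
        then have "0 \<le> (\<integral>y. frechet_derivative \<psi> (at y) (w s y) \<partial>\<mu> s)"
          by (rule integral_nonneg_AE)
        then show ?thesis by simp
      qed simp
    qed
    then have "0 \<le> (LINT s:{0..t}|lborel. (\<integral>y. frechet_derivative \<psi> (at y) (w s y) \<partial>\<mu> s))"
      unfolding set_lebesgue_integral_def by (rule integral_nonneg_AE)
    then have "g t \<ge> g 0" using weak[OF \<psi>(1) t] by (simp add: g_def)
    also have "g 0 = 1" using g1_iff[of 0] supp_\<rho> by simp
    finally show "g t \<ge> 1" .
  qed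
  moreover have "g t \<le> 1"
    using g_le[OF t] prob_space.prob_le_1[OF csp(2)[OF t], of G] by linarith
  ultimately have "msupport (\<mu> t) \<subseteq> (\<Union>i\<in>I. cball (x i) \<rho>)"
    using g1_iff[OF t] t by (auto intro: antisym)
  also have "\<dots> \<subseteq> \<omega> I r" using \<rho> by (auto simp: \<omega>_def)
  finally show ?thesis .
qed

theorem theorem2p4:
  fixes a :: "real \<Rightarrow> real"
    and M c r R \<epsilon> :: real
    and N :: nat
    and x :: "nat \<Rightarrow> 'a::euclidean_space"
    and \<mu>\<^sub>0 :: "'a measure"
    and \<omega> :: "'a set"
    and u :: "real \<Rightarrow> 'a \<Rightarrow> 'a"
  assumes a_lipschitz: "\<exists>L. L-lipschitz_on {0..} a"
    and a_nonneg: "\<And>s. s \<ge> 0 \<Longrightarrow> a s \<ge> 0"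
    and a_limit: "((\<lambda>s. s * a s) \<longlongrightarrow> 0) at_top"
    and M_pos: "M > 0" and c_pos: "c > 0"
    and N_ge_2: "N \<ge> 2"
    and r_pos: "r > 0"
    and r_small: "real N * measure lebesgue (ball (0::'a) r) \<le> c"
    and R_gt: "R > 2 * r"
    and R_large: "\<And>s. s \<ge> R - 2 * r \<Longrightarrow> s * a s \<le> \<epsilon>"
    and eps_less: "\<epsilon> < M"
    and x_separated: "\<And>i j. i \<in> {1..N} \<Longrightarrow> j \<in> {1..N} \<Longrightarrow> i \<noteq> j \<Longrightarrow> norm (x i - x j) \<ge> R"
    and mu0_prob: "compactly_supported_probability \<mu>\<^sub>0"
    and mu0_support: "msupport \<mu>\<^sub>0 \<subseteq> (\<Union>i\<in>{1..N}. ball (x i) r)"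
    and omega_def: "\<omega> = (\<Union>i\<in>{1..N}. ball (x i) r)"
    and u_inside: "\<And>t i y. i \<in> {1..N} \<Longrightarrow> y \<in> ball (x i) r - {x i} \<Longrightarrow>
      u t y = - (M *\<^sub>R ((y - x i) /\<^sub>R norm (y - x i)))"
    and u_outside: "\<And>t y. y \<notin> (\<Union>i\<in>{1..N}. ball (x i) r - {x i}) \<Longrightarrow> u t y = 0"
  shows "\<omega> \<in> control_sets c \<and> u \<in> control_functions M \<and>
    (\<forall>\<mu>. kinetic_solution a \<omega> u \<mu>\<^sub>0 \<mu> \<longrightarrow>
      (\<forall>t\<ge>0. msupport (\<mu> t) \<subseteq> (\<Union>i\<in>{1..N}. ball (x i) r)))"
proof (intro conjI allI impI)
  let ?I = "{1..N}"
  have sep: "norm (x i - x j) \<ge> 2 * r" if "i \<in> ?I" "j \<in> ?I" "i \<noteq> j" for i j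
    using x_separated[OF that] R_gt by simp
  show "\<omega> \<in> control_sets c"
    unfolding omega_def by (rule UN_ball_in_control_sets) (use r_small in auto)
  show "u \<in> control_functions M"
    by (rule cluster_feedback_in_control_functions[where I = ?I and x = x and r = r])
      (use M_pos sep u_inside u_outside in auto)
  obtain L where "L-lipschitz_on {0..} a" using a_lipschitz by blast
  then have a_cont: "continuous_on {0..} a" by (rule lipschitz_on_continuous_on)
  have u: "u t y = - (M *\<^sub>R sgn (y - x i))" if "i \<in> ?I" "y \<in> ball (x i) r - {x i}" for t i y
    using u_inside[OF that] by (simp add: sgn_div_norm)
  fix \<mu> t assume "kinetic_solution a \<omega> u \<mu>\<^sub>0 \<mu>" "t \<ge> (0::real)"
  then show "msupport (\<mu> t) \<subseteq> (\<Union>i\<in>?I. ball (x i) r)"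
    by (intro kinetic_solution_clusters_invariant[OF finite_atLeastAtMost r_pos R_gt eps_less a_cont a_nonneg
          a_limit R_large x_separated u mu0_support]) (simp_all add: omega_def)
qed

end
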